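(* Let $b,r\ge 1$ and let $S$ be a standard skew tableau with $b$ rows, each of size $r$. Then $S$ stabilizes at $b$; consequently $\operatorname{stab}(S)\le b$.
   Context: Tableaux use English notation; rows are indexed from top to bottom. A standard skew tableau with $m$ cells is a filling of a skew shape by $1,\dots,m$, each used once, increasing along rows and down columns. The row vector of a skew tableau is the sequence of its row lengths from top to bottom; it is "decreasing" if these lengths weakly decrease from top to bottom. $\operatorname{Rect}(S)$ denotes the jeu de taquin rectification of $S$. The reading word of a skew tableau reads each row left to right, from the bottom row to the top row. For a word $u$ and an integer $m$, $u+m$ adds $m$ to every letter, and $u^{(k)}=u\,(u+m)\,(u+2m)\cdots(u+(k-1)m)$ (with $m$ understood from context). For a standard skew tableau $S$ with $m$ cells and decreasing row vector and $k\ge 1$, $S^{(k)}$ is the standard skew tableau obtained by attaching $k-1$ shifted copies of $S$ to the right of $S$: row $i$ of $S^{(k)}$ begins in the same column as row $i$ of $S$ and consists of the entries of row $i$ of $S$, followed by these entries plus $m$, followed by these entries plus $2m$, ..., followed by these entries plus $(k-1)m$. (Thus if $w_1,\dots,w_b$ are the rows of $S$ read left to right, starting from the bottom row, the reading word of $S^{(k)}$ is $w_1^{(k)}\cdots w_b^{(k)}$.) $S$ stabilizes at $k$ if every entry in $[(k-1)m+1,km]$ lies in the same row of $\operatorname{Rect}(S^{(k)})$ as in $S^{(k)}$; $\operatorname{stab}(S)$ is the least $k\ge1$ at which $S$ stabilizes. *)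

theory Defs
  imports Main
begin

text \<open>Cells are pairs (row, column), rows indexed from 0 top to bottom, columns from 0
  left to right (English notation).  A (partial) filling of cells by positive integers is
  a map from cells to nat.\<close>

type_synonym tableau = "nat \<times> nat \<Rightarrow> nat option"

definition is_partition :: "nat list \<Rightarrow> bool" where
  "is_partition p \<longleftrightarrow> sorted_wrt (\<ge>) p"

definition skew_diagram :: "nat list \<Rightarrow> nat list \<Rightarrow> (nat \<times> nat) set" where
  "skew_diagram lam mu =
     {(i, j). i < length lam \<and> (if i < length mu then mu ! i else 0) \<le> j \<and> j < lam ! i}"

definition is_skew_shape :: "(nat \<times> nat) set \<Rightarrow> bool" where
  "is_skew_shape D \<longleftrightarrow>
     (\<exists>lam mu. is_partition lam \<and> is_partition mu \<and> length mu \<le> length lam \<and>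
        (\<forall>i < length mu. mu ! i \<le> lam ! i) \<and> D = skew_diagram lam mu)"

definition standard_skew_tableau :: "tableau \<Rightarrow> nat \<Rightarrow> bool" where
  "standard_skew_tableau T m \<longleftrightarrow>
     is_skew_shape (dom T) \<and> card (dom T) = m \<and> ran T = {1..m} \<and>
     (\<forall>i j j'. (i, j) \<in> dom T \<longrightarrow> (i, j') \<in> dom T \<longrightarrow> j < j' \<longrightarrow>
                the (T (i, j)) < the (T (i, j'))) \<and>
     (\<forall>i i' j. (i, j) \<in> dom T \<longrightarrow> (i', j) \<in> dom T \<longrightarrow> i < i' \<longrightarrow>
                the (T (i, j)) < the (T (i', j)))"

definition row_cols :: "tableau \<Rightarrow> nat \<Rightarrow> nat set" where
  "row_cols T i = {j. (i, j) \<in> dom T}"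

definition row_len :: "tableau \<Rightarrow> nat \<Rightarrow> nat" where
  "row_len T i = card (row_cols T i)"

definition row_start :: "tableau \<Rightarrow> nat \<Rightarrow> nat" where
  "row_start T i = Min (row_cols T i)"

definition tab_power :: "tableau \<Rightarrow> nat \<Rightarrow> tableau" where
  "tab_power S k = (\<lambda>(i, j).
     if row_cols S i \<noteq> {} \<and> row_start S i \<le> j \<and> j < row_start S i + k * row_len S i
     then (let d = j - row_start S i
           in map_option (\<lambda>x. x + (d div row_len S i) * card (dom S))
                (S (i, row_start S i + d mod row_len S i)))
     else None)"

text \<open>Jeu de taquin.  The "holes" of T are the empty cells lying weakly north-west of
  some cell of T (the cells of the inner shape that still matter).  A slide into an inner
  corner moves the hole right/down, each time moving the smaller of the right and lower
  neighbours into the hole, until the hole has no neighbour to the right or below.\<close>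

definition holes :: "tableau \<Rightarrow> (nat \<times> nat) set" where
  "holes T = {(i, j). (i, j) \<notin> dom T \<and> (\<exists>i' j'. (i', j') \<in> dom T \<and> i \<le> i' \<and> j \<le> j')}"

fun jdt_hole :: "nat \<Rightarrow> tableau \<Rightarrow> nat \<times> nat \<Rightarrow> tableau" where
  "jdt_hole 0 T h = T"
| "jdt_hole (Suc n) T (i, j) =
     (case (T (i, Suc j), T (Suc i, j)) of
        (None, None) \<Rightarrow> T
      | (Some a, None) \<Rightarrow> jdt_hole n (T((i, j) := Some a, (i, Suc j) := None)) (i, Suc j)
      | (None, Some b) \<Rightarrow> jdt_hole n (T((i, j) := Some b, (Suc i, j) := None)) (Suc i, j)
      | (Some a, Some b) \<Rightarrow>
          if a < b then jdt_hole n (T((i, j) := Some a, (i, Suc j) := None)) (i, Suc j)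
          else jdt_hole n (T((i, j) := Some b, (Suc i, j) := None)) (Suc i, j))"

definition jdt_step :: "tableau \<Rightarrow> tableau" where
  "jdt_step T =
     (if holes T = {} then T
      else (let i0 = Max (fst ` holes T); j0 = Max {j. (i0, j) \<in> holes T}
            in jdt_hole (Suc (card (dom T))) T (i0, j0)))"

definition rect :: "tableau \<Rightarrow> tableau" where
  "rect T = (jdt_step ^^ (LEAST n. holes ((jdt_step ^^ n) T) = {})) T"

definition stabilizes_at :: "tableau \<Rightarrow> nat \<Rightarrow> bool" where
  "stabilizes_at S k \<longleftrightarrow>
     (\<forall>x \<in> {(k - 1) * card (dom S) + 1 .. k * card (dom S)}.
        \<forall>i j i' j'. tab_power S k (i, j) = Some x \<longrightarrow> rect (tab_power S k) (i', j') = Some x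
           \<longrightarrow> i = i')"

definition stab :: "tableau \<Rightarrow> nat" where
  "stab S = (LEAST k. 1 \<le> k \<and> stabilizes_at S k)"

end

theory Submission
  imports Defs
begin

text \<open>
  A standard skew tableau is determined by the starts of its rows and by the word recording the
  row of each successive entry; for \<open>S\<^sup>(\<^sup>k\<^sup>)\<close> this word is the \<open>k\<close>-th power of a word \<open>u\<close> in which every
  letter occurs \<open>r\<close> times.  Rectifying from the bottom row upwards, the slides starting in row \<open>c\<close>
  together act on the word like a tandem of queues: letters \<open>c\<close> are arrivals at queue \<open>c\<close>, a letter
  \<open>y > c\<close> serves queue \<open>y - 1\<close>, passing a customer on to queue \<open>y\<close>, and it becomes \<open>y - 1\<close> exactly
  when that queue is empty.  Stability means that no queue is empty when served.

  For the periodic input \<open>u u u \<dots>\<close>, subtract from the number of letters \<open>j\<close> the constant that makes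
  neighbouring counts touch once per period (at time \<open>peak\<close>) without crossing; call the result
  \<open>steady j\<close>.  The suitably shifted customer counts \<open>load c j\<close> decrease in \<open>c\<close> and in \<open>j\<close>, and are
  bounded below by \<open>steady j\<close>.  At a touching time of \<open>steady (j - 1)\<close> and \<open>steady j\<close>, equality for
  \<open>j - 1\<close> forces equality for \<open>j\<close>, and it persists once \<open>load (c + d) (j + d)\<close> has also settled for
  all \<open>d \<ge> 1\<close>.  Between two neighbouring indices at most one of the two directions of this
  propagation has to wait for a new period, so all loads are settled after \<open>b - 1\<close> periods.
\<close>

section \<open>Periodic input to tandem queues\<close>

text \<open>Entries are shifted by one: \<open>w s\<close> is the row of the entry \<open>Suc s\<close>.\<close>

definition cnt :: "(nat \<Rightarrow> nat) \<Rightarrow> nat \<Rightarrow> nat \<Rightarrow> nat" where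
  "cnt w i t = card {s. s < t \<and> w s = i}"

lemma card_less_Suc_Collect:
  "card {s. s < Suc t \<and> P s} = card {s. s < t \<and> P s} + (if P t then 1 else 0)"
proof -
  have "{s. s < Suc t \<and> P s} = (if P t then insert t {s. s < t \<and> P s} else {s. s < t \<and> P s})"
    by (auto simp: less_Suc_eq)
  then show ?thesis by simp
qed

lemma cnt_0 [simp]: "cnt w i 0 = 0"
  by (simp add: cnt_def)

lemma cnt_Suc [simp]: "cnt w i (Suc t) = cnt w i t + (if w t = i then 1 else 0)"
  unfolding cnt_def by (rule card_less_Suc_Collect)

text \<open>The condition at \<open>t\<close> involves \<open>w'\<close> only before
  \<open>t\<close>, so it determines \<open>w'\<close> recursively from \<open>w\<close>.\<close>

definition raises :: "nat \<Rightarrow> (nat \<Rightarrow> nat) \<Rightarrow> (nat \<Rightarrow> nat) \<Rightarrow> bool" where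
  "raises c w w' \<longleftrightarrow> (\<forall>t. w' t =
     (if c < w t \<and> cnt w' (w t - 1) t = cnt w (w t) t then w t - 1 else w t))"

text \<open>\<open>R c\<close> is the row word after the slides starting in rows \<open>\<ge> c\<close>; \<open>R b\<close> is the original one.\<close>

locale cascade =
  fixes b m r :: nat and R :: "nat \<Rightarrow> nat \<Rightarrow> nat"
  assumes m_pos: "0 < m"
    and letters: "R b t < b"
    and period: "i < b \<Longrightarrow> cnt (R b) i (t + m) = cnt (R b) i t + r"
    and raises: "c < b \<Longrightarrow> raises c (R (Suc c)) (R c)"
begin

lemma step:
  assumes "c < b"
  shows "R c t =
    (if c < R (Suc c) t \<and> cnt (R c) (R (Suc c) t - 1) t = cnt (R (Suc c)) (R (Suc c) t) t
     then R (Suc c) t - 1 else R (Suc c) t)"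
  using raises[OF assms] unfolding raises_def by blast

text \<open>The number of customers that have entered queue \<open>j\<close> of the \<open>c\<close>-th tandem.\<close>

definition served :: "nat \<Rightarrow> nat \<Rightarrow> nat \<Rightarrow> nat" where
  "served c j t = card {s. s < t \<and> R (Suc c) s = j \<and> R c s = j}"

lemma served_0 [simp]: "served c j 0 = 0"
  by (simp add: served_def)

lemma served_Suc [simp]:
  "served c j (Suc t) = served c j t + (if R (Suc c) t = j \<and> R c t = j then 1 else 0)"
  unfolding served_def by (rule card_less_Suc_Collect)

lemma step_cases:
  assumes "c < b"
  shows "R c t = R (Suc c) t \<or> c < R (Suc c) t \<and> R (Suc c) t = Suc (R c t)"
  using step[OF assms, of t] by (auto split: if_splits)

lemma letter_stays:
  assumes "c \<le> b" "R b t \<le> c"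
  shows "R c t = R b t"
  using assms
proof (induction rule: inc_induct)
  case (step n) then show ?case using step_cases[of n t] by force
qed simp

lemma letter_ge:
  assumes "c \<le> b" "c \<le> R b t"
  shows "c \<le> R c t"
  using assms
proof (induction rule: inc_induct)
  case (step n)
  show ?case
  proof (cases "R b t = n")
    case True then show ?thesis using letter_stays[of n t] step.hyps by simp
  next
    case False
    then have "Suc n \<le> R (Suc n) t" using step by simp
    then show ?thesis using step_cases[of n t] step.hyps by auto
  qed
qed simp

lemma letter_le:
  assumes "c \<le> d" "d \<le> b"
  shows "R c t \<le> R d t" and "R d t \<le> R c t + (d - c)"
proof -
  have "R c t \<le> R d t \<and> R d t \<le> R c t + (d - c)"
    using assms
  proof (induction rule: inc_induct)
    case (step n) then show ?case using step_cases[of n t] by force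
  qed simp
  then show "R c t \<le> R d t" and "R d t \<le> R c t + (d - c)" by auto
qed

text \<open>A letter \<open>i\<close> of \<open>R c\<close> is an unchanged \<open>i\<close> or a
  lowered \<open>Suc i\<close>. Hence the test in \<open>raises\<close> is equality of two
  \<open>served\<close> counts, that is, an empty queue.\<close>

lemma balance:
  assumes "c < b"
  shows "cnt (R c) i t + served c (Suc i) t = cnt (R (Suc c)) (Suc i) t + served c i t"
proof (induction t)
  case (Suc t) then show ?case using step_cases[OF assms, of t] by auto
qed simp

lemma step_served:
  assumes "c < b"
  shows "R c t = (if c < R (Suc c) t \<and> served c (R (Suc c) t - 1) t = served c (R (Suc c) t) t
       then R (Suc c) t - 1 else R (Suc c) t)"
proof (cases "R (Suc c) t")
  case (Suc i)
  then show ?thesis using step[OF assms, of t] balance[OF assms, of i t] by auto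
qed (use step[OF assms, of t] in auto)

text \<open>Slides starting below row \<open>c\<close> neither change an original letter
  \<open>c\<close> nor create a new one.\<close>

lemma served_diag:
  assumes "c < b"
  shows "served c c t = cnt (R b) c t"
proof -
  have "R (Suc c) s = c \<and> R c s = c \<longleftrightarrow> R b s = c" for s
    using letter_ge[of "Suc c" s] letter_stays[of "Suc c" s] letter_stays[of c s] assms
    by (cases "R b s \<le> c") auto
  then show ?thesis unfolding served_def cnt_def by simp
qed

text \<open>Queue lengths are nonnegative: a letter \<open>Suc j\<close> that finds queue
  \<open>j\<close> empty is lowered and not counted.\<close>

lemma served_antimono:
  assumes "c < b" "c \<le> j"
  shows "served c (Suc j) t \<le> served c j t"
proof (induction t)
  case (Suc t) then show ?case using step_served[OF assms(1), of t] assms by auto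
qed simp

section \<open>Normalized counts and comparison of loads\<close>

definition excess :: "nat \<Rightarrow> nat \<Rightarrow> int" where
  "excess i t = int (cnt (R b) (Suc i) t) - int (cnt (R b) i t)"

definition lag :: "nat \<Rightarrow> int" where
  "lag i = Max (excess i ` {..<m})"

lemma cnt_period: "i < b \<Longrightarrow> cnt (R b) i (t + k * m) = cnt (R b) i t + k * r"
proof (induction k)
  case (Suc k) then show ?case using period[of i "t + k * m"] by (simp add: algebra_simps)
qed simp

lemma excess_period: "Suc i < b \<Longrightarrow> excess i (t + k * m) = excess i t"
  by (simp add: excess_def cnt_period)

lemma excess_le: "Suc i < b \<Longrightarrow> excess i t \<le> lag i"
  using excess_period[of i "t mod m" "t div m"] m_pos by (simp add: lag_def)

lemma lag_nonneg: "0 \<le> lag i"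
proof -
  have "excess i 0 \<le> lag i" unfolding lag_def using m_pos by (intro Max_ge) auto
  then show ?thesis by (simp add: excess_def)
qed

definition peak :: "nat \<Rightarrow> nat" where
  "peak i = (SOME t. t < m \<and> excess i t = lag i)"

lemma peak: "peak i < m" "excess i (peak i) = lag i"
proof -
  have "lag i \<in> excess i ` {..<m}" unfolding lag_def using m_pos by (intro Max_in) auto
  then have "\<exists>t. t < m \<and> excess i t = lag i" by auto
  from someI_ex[OF this] show "peak i < m" "excess i (peak i) = lag i"
    unfolding peak_def by auto
qed

definition level :: "nat \<Rightarrow> int" where
  "level j = (\<Sum>i<j. lag i)"

lemma level_Suc [simp]: "level (Suc j) = level j + lag j"
  by (simp add: level_def)

definition steady :: "nat \<Rightarrow> nat \<Rightarrow> int" where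
  "steady j t = int (cnt (R b) j t) - level j"

text \<open>The shift is \<open>level c\<close>, not \<open>level j\<close>: differences within one
  tandem remain queue lengths, and \<open>load c c\<close> becomes \<open>steady c\<close>.\<close>

definition load :: "nat \<Rightarrow> nat \<Rightarrow> nat \<Rightarrow> int" where
  "load c j t = int (served c j t) - level c"

lemma steady_antimono: "Suc i < b \<Longrightarrow> steady (Suc i) t \<le> steady i t"
  using excess_le[of i t] by (simp add: steady_def excess_def)

lemma steady_tie: "Suc i < b \<Longrightarrow> steady (Suc i) (peak i + k * m) = steady i (peak i + k * m)"
  using excess_period[of i "peak i" k] peak[of i] by (simp add: steady_def excess_def)

lemma load_diag: "c < b \<Longrightarrow> load c c t = steady c t"
  by (simp add: load_def steady_def served_diag)

text \<open>At equality, the order can only break when a letter \<open>j\<close> survives in tandem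
  \<open>Suc c\<close> but is lowered in tandem \<open>c\<close>, whose queue \<open>j - 1\<close>
  is then empty. Comparing the preceding queues excludes this.\<close>

lemma load_mono:
  "Suc c \<le> j \<Longrightarrow> j < b \<Longrightarrow> load (Suc c) j t \<le> load c j t"
proof (induction t arbitrary: c j)
  case 0
  then show ?case using lag_nonneg[of c] by (simp add: load_def)
next
  case (Suc t)
  have IH: "load (Suc c) j t \<le> load c j t" using Suc by simp
  show ?case
  proof (cases "R (Suc (Suc c)) t = j \<and> R (Suc c) t = j \<and> R c t \<noteq> j \<and> load (Suc c) j t = load c j t")
    case False
    then show ?thesis using IH by (auto simp: load_def)
  next
    case True
    obtain i where j: "j = Suc i" using Suc.prems by (cases j) auto
    have c: "c < b" "Suc c < b" using Suc.prems by auto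
    have blocked: "load c i t = load c j t"
      using step_served[OF c(1), of t] True j by (auto simp: load_def split: if_splits)
    show ?thesis
    proof (cases "Suc c = j")
      \<comment> \<open>By \<open>load_diag\<close> the empty queue is a tie of
        \<open>steady i\<close> and \<open>steady j\<close>; a further original letter
        \<open>j\<close> would break it in the forbidden direction.\<close>
      case True': True
      have "steady i t = steady j t"
        using blocked True load_diag[OF c(1), of t] load_diag[OF c(2), of t] True' j by simp
      moreover have "R b t = j"
        using True True' letter_ge[of "Suc (Suc c)" t] letter_stays[of "Suc (Suc c)" t] c
        by (cases "R b t \<le> Suc c") auto
      ultimately have "steady (Suc i) (Suc t) > steady i (Suc t)"
        using j by (simp add: steady_def)
      then show ?thesis using steady_antimono[of i "Suc t"] j Suc.prems by simp
    next
      case False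
      then have "Suc c \<le> i" using Suc.prems j by simp
      \<comment> \<open>Queue \<open>i\<close> of tandem \<open>Suc c\<close> is nonempty, as the
        letter \<open>j\<close> survived there.\<close>
      have "served (Suc c) i t \<noteq> served (Suc c) j t"
      proof
        assume "served (Suc c) i t = served (Suc c) j t"
        moreover have "R (Suc (Suc c)) t = Suc i" "R (Suc c) t = Suc i" using True j by simp_all
        ultimately show False
          using step_served[OF c(2), of t] j \<open>Suc c \<le> i\<close> by simp
      qed
      then have "load (Suc c) j t < load (Suc c) i t"
        using served_antimono[OF c(2) \<open>Suc c \<le> i\<close>, of t] j by (simp add: load_def)
      also have "\<dots> \<le> load c i t" using Suc.IH[OF \<open>Suc c \<le> i\<close>] Suc.prems j by simp
      finally show ?thesis using blocked True by simp
    qed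
  qed
qed

lemma load_antimono:
  assumes "c \<le> d" "d \<le> j" "j < b"
  shows "load d j t \<le> load c j t"
  using assms
proof (induction rule: inc_induct)
  case (step n)
  then show ?case using load_mono[of n j t] by simp
qed simp

lemma steady_le_load: "c \<le> j \<Longrightarrow> j < b \<Longrightarrow> steady j t \<le> load c j t"
  using load_antimono[of c j j t] load_diag[of j t] by simp

text \<open>An original letter \<open>Suc i\<close> occurs only while
  \<open>steady (Suc i) < steady i\<close>, so if \<open>load c (Suc i)\<close> is settled, queue
  \<open>i\<close> is nonempty. By \<open>load_antimono\<close> and \<open>steady_le_load\<close>
  the hypothesis passes to the tandems between \<open>c\<close> and the letter.\<close>

lemma letter_fixed:
  assumes "c \<le> R b t" and "load c (R b t) t = steady (R b t) t"
  shows "R c t = R b t"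
proof -
  let ?j = "R b t"
  have "c \<le> b" using assms letters[of t] by simp
  then show ?thesis
    using assms
  proof (induction rule: inc_induct)
    case (step n)
    show ?case
    proof (cases "n = ?j")
      case True
      then show ?thesis using letter_stays[of n t] step by simp
    next
      case False
      then have n: "Suc n \<le> ?j" using step.prems by simp
      obtain i where i: "?j = Suc i" using n by (cases ?j) auto
      have "load (Suc n) ?j t = steady ?j t"
        using load_antimono[of n "Suc n" ?j t] steady_le_load[of "Suc n" ?j t] n letters[of t]
          step.prems by simp
      with step.IH n have R: "R (Suc n) t = ?j" by simp
      have "steady ?j t < steady i t"
        using steady_antimono[of i "Suc t"] letters[of t] i by (simp add: steady_def)
      also have "\<dots> \<le> load n i t" using steady_le_load[of n i t] n i letters[of t] by simp
      finally have "served n i t \<noteq> served n ?j t" using step.prems by (auto simp: load_def)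
      then show ?thesis using step_served[of n t] step.hyps R i by auto
    qed
  qed simp
qed

section \<open>Deadlines and propagation of settled loads\<close>

fun drops :: "nat \<Rightarrow> nat" where
  "drops 0 = 0"
| "drops (Suc i) = drops i + (if peak (Suc i) < peak i then 1 else 0)"

lemma drops_le: "i \<le> j \<Longrightarrow> drops i \<le> drops j \<and> drops j \<le> drops i + (j - i)"
  by (induction rule: dec_induct) auto

text \<open>\<open>\<tau> i - c * m\<close> is the time from which \<open>load c (Suc i)\<close> agrees with \<open>steady (Suc i)\<close>.\<close>

lemma deadlines:
  obtains \<tau> :: "nat \<Rightarrow> nat" where
    "\<And>i c. Suc i < b \<Longrightarrow> c \<le> i \<Longrightarrow> c * m \<le> \<tau> i \<and> steady (Suc i) (\<tau> i - c * m) = steady i (\<tau> i - c * m)"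
    "\<And>i. Suc i < b \<Longrightarrow> \<tau> i < (b - 1) * m"
    "\<And>i. Suc (Suc i) < b \<Longrightarrow> \<tau> i \<le> \<tau> (Suc i) \<and> \<tau> (Suc i) \<le> \<tau> i + m"
proof -
  \<comment> \<open>Normalized to end at \<open>b - 2\<close>, which keeps all deadlines before
    \<open>(b - 1) * m\<close>. The period index rises exactly when the peak drops, so consecutive
    deadlines differ by at least 0 and at most \<open>m\<close>.\<close>
  define \<kappa> where "\<kappa> i = b - 2 - drops (b - 2) + drops i" for i
  have \<kappa>: "i \<le> \<kappa> i \<and> \<kappa> i \<le> b - 2" if "Suc i < b" for i
  proof -
    have "i \<le> b - 2" using that by simp
    then have "drops i \<le> drops (b - 2)" "drops (b - 2) \<le> drops i + (b - 2 - i)" "drops (b - 2) \<le> b - 2"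
      using drops_le[of i "b - 2"] drops_le[of 0 "b - 2"] by auto
    then show ?thesis using \<open>i \<le> b - 2\<close> unfolding \<kappa>_def by linarith
  qed
  define \<tau> where "\<tau> i = peak i + \<kappa> i * m" for i
  have 1: "\<tau> i - c * m = peak i + (\<kappa> i - c) * m \<and> c * m \<le> \<tau> i" if "c \<le> \<kappa> i" for i c
  proof -
    have "c * m \<le> \<kappa> i * m" using that by (rule mult_le_mono1)
    then show ?thesis unfolding \<tau>_def diff_mult_distrib by linarith
  qed
  show ?thesis
  proof
    fix i c assume "Suc i < b" "c \<le> i"
    then show "c * m \<le> \<tau> i \<and> steady (Suc i) (\<tau> i - c * m) = steady i (\<tau> i - c * m)"
      using 1[of c i] \<kappa>[of i] steady_tie[of i] by simp
  next
    fix i assume i: "Suc i < b"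
    then have "Suc (\<kappa> i) \<le> b - 1" using \<kappa>[of i] by linarith
    then have "Suc (\<kappa> i) * m \<le> (b - 1) * m" by (rule mult_le_mono1)
    then show "\<tau> i < (b - 1) * m" using peak[of i] by (simp add: \<tau>_def)
  next
    fix i
    have "\<kappa> (Suc i) = \<kappa> i + (if peak (Suc i) < peak i then 1 else 0)"
      by (simp add: \<kappa>_def)
    then show "\<tau> i \<le> \<tau> (Suc i) \<and> \<tau> (Suc i) \<le> \<tau> i + m"
      using peak(1)[of i] peak(1)[of "Suc i"] by (auto simp: \<tau>_def)
  qed
qed

theorem eventually_fixed:
  assumes "(b - 1) * m \<le> t"
  shows "R 0 t = R b t"
proof -
  obtain \<tau> where
    tie: "\<And>i c. Suc i < b \<Longrightarrow> c \<le> i \<Longrightarrow> c * m \<le> \<tau> i \<and> steady (Suc i) (\<tau> i - c * m) = steady i (\<tau> i - c * m)"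
    and bound: "\<And>i. Suc i < b \<Longrightarrow> \<tau> i < (b - 1) * m"
    and next_le: "\<And>i. Suc (Suc i) < b \<Longrightarrow> \<tau> i \<le> \<tau> (Suc i) \<and> \<tau> (Suc i) \<le> \<tau> i + m"
    using deadlines by blast
  have \<tau>_add: "\<tau> (i + d) \<le> \<tau> i + d * m" if "Suc (i + d) < b" for i d
    using that
  proof (induction d)
    case (Suc d) then show ?case using next_le[of "i + d"] by simp
  qed simp
  \<comment> \<open>Larger \<open>c\<close> come first, then smaller \<open>i\<close>: the value at
    the deadline comes from queue \<open>i\<close> of the same tandem, its persistence from the
    tandems \<open>c + d\<close>.\<close>
  have settled: "load c (Suc i) t = steady (Suc i) t"
    if "Suc i < b" "c \<le> i" "\<tau> i \<le> t + c * m" for c i t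
    using that
  proof (induction "b - c" arbitrary: c i t rule: less_induct)
    case less
    note outer = less.hyps
    show ?case using less.prems
    proof (induction i arbitrary: t rule: less_induct)
      case (less i)
      have c: "c < b" using less.prems by simp
      define t0 where "t0 = \<tau> i - c * m"
      have t0: "t0 + c * m = \<tau> i" "steady (Suc i) t0 = steady i t0"
        using tie[of i c] less.prems by (auto simp: t0_def)
      have "load c i t0 = steady i t0"
      proof (cases "i = c")
        case True then show ?thesis using load_diag c by simp
      next
        case False
        then obtain i' where i': "i = Suc i'" using less.prems by (cases i) auto
        then show ?thesis
          using less.IH[of i' t0] False less.prems next_le[of i'] t0 by simp
      qed
      \<comment> \<open>At the tie, \<open>load c (Suc i)\<close> is squeezed between
        \<open>steady (Suc i)\<close> and \<open>load c i\<close>.\<close>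
      moreover have "load c (Suc i) t0 \<le> load c i t0"
        using served_antimono[OF c, of i t0] less.prems by (simp add: load_def)
      ultimately have base: "load c (Suc i) t0 = steady (Suc i) t0"
        using t0 steady_le_load[of c "Suc i" t0] less.prems by simp
      have "t0 \<le> t" using less.prems t0 by simp
      then show ?case
      proof (induction rule: dec_induct)
        case base then show ?case using \<open>load c (Suc i) t0 = steady (Suc i) t0\<close> by simp
      next
        case (step s)
        \<comment> \<open>The load may grow only together with \<open>steady (Suc i)\<close>. An
          original letter \<open>Suc (i + d)\<close> is still intact in \<open>R (c + d)\<close>,
          and the \<open>d - 1\<close> phases from there to \<open>Suc c\<close> lower it by at most
          \<open>d - 1\<close>.\<close>
        have "R b s = Suc i" if y: "R (Suc c) s = Suc i"
        proof (rule ccontr)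
          assume neq: "R b s \<noteq> Suc i"
          have "R (Suc c) s \<le> R b s" using letter_le[of "Suc c" b s] c by simp
          with neq y obtain d where d: "R b s = Suc (i + d)" "0 < d"
            by (metis Suc_leI add_Suc less_imp_Suc_add order_neq_le_trans zero_less_Suc add_Suc_right)
          have "Suc (i + d) < b" using d letters[of s] by simp
          have "load (c + d) (Suc (i + d)) s = steady (Suc (i + d)) s"
          proof (rule outer)
            show "b - (c + d) < b - c" using d c by simp
            show "\<tau> (i + d) \<le> s + (c + d) * m"
              using \<tau>_add[OF \<open>Suc (i + d) < b\<close>] t0 step.hyps by (simp add: algebra_simps)
          qed (use \<open>Suc (i + d) < b\<close> less.prems in auto)
          then have "R (c + d) s = R b s"
            using letter_fixed[of "c + d" s] d less.prems by simp
          moreover have "R (c + d) s \<le> R (Suc c) s + (c + d - Suc c)"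
            using letter_le(2)[of "Suc c" "c + d" s] d less.prems \<open>Suc (i + d) < b\<close> by simp
          ultimately show False using y d by simp
        qed
        moreover have "steady (Suc i) (Suc s) \<le> load c (Suc i) (Suc s)"
          using steady_le_load[of c "Suc i" "Suc s"] less.prems by simp
        ultimately show ?case
          using step.IH by (auto simp: load_def steady_def split: if_splits)
      qed
    qed
  qed
  show ?thesis
  proof (cases "R b t")
    case 0 then show ?thesis using letter_stays[of 0 t] by simp
  next
    case (Suc i)
    then have "Suc i < b" using letters[of t] by simp
    then have "load 0 (R b t) t = steady (R b t) t"
      using settled[of i 0 t] bound[of i] assms Suc by simp
    then show ?thesis using letter_fixed[of 0 t] by simp
  qed
qed

end

section \<open>Jeu de taquin on row words\<close>

text \<open>The first free column of row \<open>i\<close> after \<open>t\<close> entries, that is,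
  the place of the next entry in that row.\<close>

definition row_end :: "(nat \<Rightarrow> nat) \<Rightarrow> (nat \<Rightarrow> nat) \<Rightarrow> nat \<Rightarrow> nat \<Rightarrow> nat" where
  "row_end st w i t = st i + cnt w i t"

definition cell :: "(nat \<Rightarrow> nat) \<Rightarrow> (nat \<Rightarrow> nat) \<Rightarrow> nat \<Rightarrow> nat \<times> nat" where
  "cell st w s = (w s, row_end st w (w s) s)"

definition places :: "nat \<Rightarrow> (nat \<Rightarrow> nat \<times> nat) \<Rightarrow> tableau \<Rightarrow> bool" where
  "places N p T \<longleftrightarrow> (\<forall>c x. T c = Some x \<longleftrightarrow> (\<exists>s<N. x = Suc s \<and> p s = c))"

lemma places_Some: "places N p T \<Longrightarrow> T c = Some x \<longleftrightarrow> (\<exists>s<N. x = Suc s \<and> p s = c)"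
  unfolding places_def by blast

lemma places_dom:
  assumes "places N p T"
  shows "dom T = p ` {..<N}"
proof (rule set_eqI)
  fix c
  have "c \<in> dom T \<longleftrightarrow> (\<exists>x. T c = Some x)" by (simp add: dom_def)
  also have "\<dots> \<longleftrightarrow> c \<in> p ` {..<N}" unfolding places_Some[OF assms] by blast
  finally show "c \<in> dom T \<longleftrightarrow> c \<in> p ` {..<N}" .
qed

lemma places_cong: "places N p T \<Longrightarrow> (\<And>s. s < N \<Longrightarrow> p s = q s) \<Longrightarrow> places N q T"
  unfolding places_def by metis

lemma places_move:
  assumes "places N p T" "s < N" "T h = None" "h \<noteq> p s"
  shows "places N (p(s := h)) (T(h := Some (Suc s), p s := None))"
proof -
  have inj: "s' = s" if "s' < N" "p s' = p s" for s'
    using places_Some[OF assms(1), of "p s" "Suc s"] places_Some[OF assms(1), of "p s" "Suc s'"]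
      that assms(2) by auto
  have free: "p s' \<noteq> h" if "s' < N" for s'
    using places_Some[OF assms(1), of h "Suc s'"] that assms(3) by auto
  have "(T(h := Some (Suc s), p s := None)) c = Some x \<longleftrightarrow> (\<exists>s'<N. x = Suc s' \<and> (p(s := h)) s' = c)"
    for c x
  proof -
    consider "c = p s" | "c = h" | "c \<noteq> p s" "c \<noteq> h" by blast
    then show ?thesis
    proof cases
      case 1 then show ?thesis using inj assms(4) by auto
    next
      case 2 then show ?thesis using free assms(2,4) by auto
    next
      case 3 then show ?thesis using places_Some[OF assms(1), of c x] by auto
    qed
  qed
  then show ?thesis unfolding places_def by blast
qed

lemma jdt_hole_right:
  assumes "T (i, Suc j) = Some x" "\<And>y. T (Suc i, j) = Some y \<Longrightarrow> x < y"
  shows "jdt_hole (Suc n) T (i, j) =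
    jdt_hole n (T((i, j) := Some x, (i, Suc j) := None)) (i, Suc j)"
proof (cases "T (Suc i, j)")
  case (Some y)
  then have "x < y" by (rule assms(2))
  then show ?thesis unfolding jdt_hole.simps(2) assms(1) Some by simp
qed (unfold jdt_hole.simps(2) assms(1), simp)

lemma jdt_hole_down:
  assumes "T (Suc i, j) = Some x" "\<And>y. T (i, Suc j) = Some y \<Longrightarrow> x < y"
  shows "jdt_hole (Suc n) T (i, j) =
    jdt_hole n (T((i, j) := Some x, (Suc i, j) := None)) (Suc i, j)"
proof (cases "T (i, Suc j)")
  case (Some y)
  then have "\<not> y < x" using assms(2) by fastforce
  then show ?thesis unfolding jdt_hole.simps(2) assms(1) Some by simp
qed (unfold jdt_hole.simps(2) assms(1), simp)

lemma row_end_Suc [simp]: "row_end st w i (Suc t) = row_end st w i t + (if w t = i then 1 else 0)"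
  by (simp add: row_end_def)

lemma row_end_0 [simp]: "row_end st w i 0 = st i"
  by (simp add: row_end_def)

lemma row_end_mono: "s \<le> t \<Longrightarrow> row_end st w i s \<le> row_end st w i t"
  by (induction rule: dec_induct) auto

lemma row_end_less: "s < t \<Longrightarrow> row_end st w (w s) s < row_end st w (w s) t"
  using row_end_mono[of "Suc s" t st w "w s"] by simp

text \<open>The ballot condition shifted by the row starts; it encodes increasing columns and, at
  \<open>t = 0\<close>, the inner shape.\<close>

definition lattice_word :: "(nat \<Rightarrow> nat) \<Rightarrow> (nat \<Rightarrow> nat) \<Rightarrow> bool" where
  "lattice_word st w \<longleftrightarrow> (\<forall>i t. row_end st w (Suc i) t \<le> row_end st w i t)"

section \<open>A single slide as an operation on row words\<close>

locale slide =
  fixes st w :: "nat \<Rightarrow> nat" and c :: nat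
  assumes lattice: "row_end st w (Suc i) t \<le> row_end st w i t"
    and corner: "st (Suc c) < st c"
begin

text \<open>The row of the hole after the entries up to \<open>t\<close> have been taken into account: the next entry
  crosses the hole from below if and only if it lies directly below the hole.\<close>

fun hole_row :: "nat \<Rightarrow> nat" where
  "hole_row 0 = c"
| "hole_row (Suc t) =
    (if w t = Suc (hole_row t) \<and> Suc (row_end st w (Suc (hole_row t)) t) = row_end st w (hole_row t) t
     then Suc (hole_row t) else hole_row t)"

definition word :: "nat \<Rightarrow> nat" where
  "word t =
    (if w t = Suc (hole_row t) \<and> Suc (row_end st w (Suc (hole_row t)) t) = row_end st w (hole_row t) t
     then hole_row t else w t)"

definition starts :: "nat \<Rightarrow> nat" where
  "starts = st(c := st c - 1)"

text \<open>When the hole drops, the entry causing this has just lengthened the row it drops to,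
  which therefore ends strictly beyond the next one.\<close>

lemma gap: "row_end st w (Suc (hole_row t)) t < row_end st w (hole_row t) t"
proof (induction t)
  case (Suc t)
  show ?case
  proof (cases "hole_row (Suc t) = hole_row t")
    case True
    then show ?thesis using Suc by (auto split: if_splits)
  next
    case False
    then have "w t = Suc (hole_row t)" "hole_row (Suc t) = Suc (hole_row t)"
      by (auto split: if_splits)
    then show ?thesis using lattice[of "Suc (hole_row t)" t] by simp
  qed
qed (simp add: corner)

lemma row_end_word:
  "row_end starts word i t = row_end st w i t - (if i = hole_row t then 1 else 0)"
proof (induction t)
  case 0 then show ?case by (simp add: starts_def)
next
  case (Suc t)
  then show ?case using gap[of t] by (auto simp: word_def)
qed

lemma lattice': "row_end starts word (Suc i) t \<le> row_end starts word i t"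
  using lattice[of i t] gap[of t] by (auto simp: row_end_word)

text \<open>During a slide, the entries up to some \<open>t\<close> already are in their new cells and the later ones still
  are in their old cells.\<close>

definition mixed :: "nat \<Rightarrow> nat \<Rightarrow> nat \<times> nat" where
  "mixed t s = (if s < t then cell starts word s else cell st w s)"

definition hole :: "nat \<Rightarrow> nat \<times> nat" where
  "hole t = (hole_row t, row_end st w (hole_row t) t - 1)"

lemma moved_left:
  assumes "s < t" "mixed t s = (i, j)"
  shows "j < row_end starts word i t"
  using assms row_end_less[of s t starts word] by (auto simp: mixed_def cell_def)

text \<open>Moved entries lie left of the new row ends, the hole and its two neighbours do
  not.\<close>

lemma moved_not_ahead:
  assumes "s < t"
  shows "mixed t s \<noteq> (hole_row t, Suc (row_end st w (hole_row t) t - 1))"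
    and "mixed t s \<noteq> (Suc (hole_row t), row_end st w (hole_row t) t - 1)"
    and "mixed t s \<noteq> hole t"
  using moved_left[OF assms] gap[of t] lattice'[of "hole_row t" t]
  by (fastforce simp: row_end_word hole_def)+

text \<open>Scanning the entries in increasing order replaces the comparison of neighbours: the
  first one met is the smaller. Each scanned entry uses at most one unit of
  \<open>n\<close>.\<close>

lemma jdt_hole_slide:
  assumes "t \<le> N" "places N (mixed t) T" "N - t \<le> n"
  shows "places N (cell starts word) (jdt_hole n T (hole t))"
  using assms
proof (induction arbitrary: T n rule: inc_induct)
  case base
  have "T (hole_row N, Suc (row_end st w (hole_row N) N - 1)) = None"
    "T (Suc (hole_row N), row_end st w (hole_row N) N - 1) = None"
    using moved_not_ahead[of _ N] places_Some[OF base(1)] not_None_eq by (metis (no_types, lifting))+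
  then have "jdt_hole n T (hole N) = T"
    by (cases n) (auto simp: hole_def)
  moreover have "places N (cell starts word) T"
    by (rule places_cong[OF base(1)]) (simp add: mixed_def)
  ultimately show ?case by simp
next
  case (step t)
  let ?h = "hole_row t" and ?e = "row_end st w (hole_row t) t"
  obtain n' where n: "n = Suc n'" using step.hyps step.prems(2) by (cases n) auto
  have e: "0 < ?e" using gap[of t] by simp
  then have Suc_e: "Suc (?e - 1) = ?e" by simp
  have ht: "hole t = (?h, ?e - 1)" by (simp add: hole_def)
  have later: "Suc t \<le> x \<and> (x = Suc t \<longrightarrow> cell st w t = d)"
    if Tx: "T d = Some x" and d: "d = (?h, ?e) \<or> d = (Suc ?h, ?e - 1)" for d x
  proof -
    obtain s where s: "s < N" "x = Suc s" "mixed t s = d"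
      using places_Some[OF step.prems(1)] Tx by metis
    then have "\<not> s < t" using moved_not_ahead[of s t] d e by auto
    then show ?thesis using s by (auto simp: mixed_def)
  qed
  have here: "T (cell st w t) = Some (Suc t)"
    using places_Some[OF step.prems(1)] step.hyps by (auto simp: mixed_def)
  have next_mixed: "mixed (Suc t) s = ((mixed t)(t := cell starts word t)) s" for s
    by (simp add: mixed_def less_Suc_eq)
  have move: "places N (mixed (Suc t)) (T(hole t := Some (Suc t), cell st w t := None))"
    if "cell starts word t = hole t" "hole t \<noteq> cell st w t"
  proof -
    \<comment> \<open>Unmoved entries in the row of the hole start at column \<open>?e\<close>, one
      past the hole.\<close>
    have "T (hole t) = None"
    proof (rule ccontr)
      assume "T (hole t) \<noteq> None"
      then obtain s where s: "mixed t s = hole t"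
        using places_Some[OF step.prems(1)] by (metis not_None_eq)
      then have "\<not> s < t" using moved_not_ahead(3) by blast
      then have *: "cell st w s = hole t" "t \<le> s" using s by (auto simp: mixed_def)
      then have "row_end st w ?h s = ?e - 1" by (auto simp: cell_def hole_def)
      with row_end_mono[OF *(2), of st w ?h] e show False by simp
    qed
    have mt: "mixed t t = cell st w t" by (simp add: mixed_def)
    have "places N ((mixed t)(t := hole t)) (T(hole t := Some (Suc t), mixed t t := None))"
      using places_move[OF step.prems(1) step.hyps(2) \<open>T (hole t) = None\<close>] that(2) mt by simp
    then have "places N (mixed (Suc t)) (T(hole t := Some (Suc t), mixed t t := None))"
      by (rule places_cong) (use that(1) next_mixed in simp)
    then show ?thesis unfolding mt .
  qed
  consider (right) "w t = ?h" | (down) "w t = Suc ?h" "Suc (row_end st w (Suc ?h) t) = ?e"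
    | (stay) "w t \<noteq> ?h" "\<not> (w t = Suc ?h \<and> Suc (row_end st w (Suc ?h) t) = ?e)"
    by blast
  then show ?case
  proof cases
    case right
    have c0: "cell st w t = (?h, ?e)" "cell starts word t = hole t"
      using right by (simp_all add: cell_def word_def row_end_word hole_def)
    have nh: "hole (Suc t) = (?h, ?e)" using right by (simp add: hole_def)
    have below: "T (Suc ?h, ?e - 1) = Some x \<Longrightarrow> Suc t < x" for x
      using later[of "(Suc ?h, ?e - 1)" x] c0 by (cases "x = Suc t") auto
    have "jdt_hole n T (hole t) = jdt_hole n' (T(hole t := Some (Suc t), cell st w t := None)) (hole (Suc t))"
      using jdt_hole_right[of T ?h "?e - 1" "Suc t" n'] here below
      unfolding c0(1) nh n ht Suc_e by blast
    moreover have "hole t \<noteq> cell st w t" using c0(1) ht e by simp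
    moreover have "N - Suc t \<le> n'" using step.prems(2) n by simp
    ultimately show ?thesis using step.IH[OF move[OF c0(2)], of n'] by (simp only: simp_thms)
  next
    case down
    have c0: "cell st w t = (Suc ?h, ?e - 1)" "cell starts word t = hole t"
      using down by (auto simp add: cell_def word_def row_end_word hole_def)
    have nh: "hole (Suc t) = (Suc ?h, ?e - 1)" using down by (simp add: hole_def)
    have right: "T (?h, ?e) = Some x \<Longrightarrow> Suc t < x" for x
      using later[of "(?h, ?e)" x] c0 by (cases "x = Suc t") auto
    have "jdt_hole n T (hole t) = jdt_hole n' (T(hole t := Some (Suc t), cell st w t := None)) (hole (Suc t))"
      using jdt_hole_down[of T ?h "?e - 1" "Suc t" n'] here right
      unfolding c0(1) nh n ht Suc_e by blast
    moreover have "hole t \<noteq> cell st w t" using c0(1) ht by simp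
    moreover have "N - Suc t \<le> n'" using step.prems(2) n by simp
    ultimately show ?thesis using step.IH[OF move[OF c0(2)], of n'] by (simp only: simp_thms)
  next
    case stay
    have "cell starts word t = cell st w t" "hole (Suc t) = hole t"
      using stay by (auto simp: cell_def word_def row_end_word hole_def)
    then have "places N (mixed (Suc t)) T"
      using next_mixed by (intro places_cong[OF step.prems(1)]) (auto simp: mixed_def)
    then show ?thesis using step.IH[of T n] step.prems(2) \<open>hole (Suc t) = hole t\<close> by simp
  qed
qed

end

section \<open>Domains, holes and the steps of rectification\<close>

lemma cell_inj:
  assumes "cell st w s = cell st w s'"
  shows "s = s'"
proof (rule ccontr)
  assume "s \<noteq> s'"
  then show False
    using assms row_end_less[of s s' st w] row_end_less[of s' s st w]
    by (cases s s' rule: linorder_cases) (auto simp: cell_def)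
qed

lemma cell_surj:
  assumes "st i \<le> j" "j < row_end st w i N"
  shows "\<exists>s<N. cell st w s = (i, j)"
  using assms
proof (induction N)
  case (Suc N)
  then show ?case
    by (cases "j < row_end st w i N") (auto simp: cell_def less_Suc_eq split: if_splits)
qed simp

lemma places_cell_dom:
  assumes "places N (cell st w) T"
  shows "(i, j) \<in> dom T \<longleftrightarrow> st i \<le> j \<and> j < row_end st w i N"
proof
  assume "(i, j) \<in> dom T"
  then obtain s where "s < N" "cell st w s = (i, j)" unfolding places_dom[OF assms] by force
  then show "st i \<le> j \<and> j < row_end st w i N"
    using row_end_less[of s N st w] by (auto simp: cell_def row_end_def)
next
  assume "st i \<le> j \<and> j < row_end st w i N"
  then show "(i, j) \<in> dom T" unfolding places_dom[OF assms] using cell_surj[of st i j w N] by force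
qed

lemma lattice_word_antimono:
  assumes "lattice_word st w" "i \<le> i'"
  shows "row_end st w i' t \<le> row_end st w i t"
  using assms(2)
proof (induction rule: dec_induct)
  case (step n)
  then show ?case using assms(1) unfolding lattice_word_def by (meson order_trans)
qed simp

lemma holes_places:
  assumes "places N (cell st w) T" "lattice_word st w"
  shows "(i, j) \<in> holes T \<longleftrightarrow> j < st i \<and> (\<exists>i' j'. (i', j') \<in> dom T \<and> i \<le> i' \<and> j \<le> j')"
proof -
  let ?E = "\<exists>i' j'. (i', j') \<in> dom T \<and> i \<le> i' \<and> j \<le> j'"
  have "j < row_end st w i N" if ?E
  proof -
    from that obtain i' j' where *: "(i', j') \<in> dom T" "i \<le> i'" "j \<le> j'" by blast
    then show ?thesis
      using lattice_word_antimono[OF assms(2) *(2), of N] places_cell_dom[OF assms(1), of i' j']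
      by simp
  qed
  moreover have "(i, j) \<in> holes T \<longleftrightarrow> (i, j) \<notin> dom T \<and> ?E" unfolding holes_def by simp
  ultimately show ?thesis
    using places_cell_dom[OF assms(1), of i j] by (meson leD leI)
qed

text \<open>Row \<open>c\<close> is nonempty and is the lowest with a positive start, so
  \<open>jdt_step\<close> selects the cell \<open>(c, st c - 1)\<close>, the initial hole of the
  locale.\<close>

lemma jdt_step_slide:
  assumes T: "places N (cell st w) T" and lat: "lattice_word st w"
    and c: "0 < st c" "\<And>i. c < i \<Longrightarrow> st i = 0" and s: "s < N" "w s = c"
  shows "places N (cell (slide.starts st c) (slide.word st w c)) (jdt_step T)"
proof -
  interpret slide st w c
    using lat c unfolding lattice_word_def by unfold_locales auto
  have "(c, st c) \<in> dom T"
    using s places_cell_dom[OF T, of c "st c"] row_end_less[of s N st w] by (simp add: row_end_def)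
  then have row_c: "(c, j) \<in> holes T \<longleftrightarrow> j < st c" for j
    using holes_places[OF T lat, of c j] by (auto intro: less_imp_le)
  have rows: "i \<le> c \<and> j \<le> row_end st w 0 N" if hole: "(i, j) \<in> holes T" for i j
  proof -
    obtain i' j' where "j < st i" "(i', j') \<in> dom T" "j \<le> j'"
      using hole holes_places[OF T lat, of i j] by blast
    then show ?thesis
      using c(2)[of i] places_cell_dom[OF T, of i' j'] lattice_word_antimono[OF lat, of 0 i' N]
      by (cases "c < i") auto
  qed
  have "holes T \<subseteq> {..c} \<times> {..row_end st w 0 N}" using rows by auto
  then have "finite (holes T)" by (rule finite_subset) simp
  then have i0: "Max (fst ` holes T) = c"
    using rows row_c[of 0] c(1) by (intro Max_eqI) force+
  have "{j. (c, j) \<in> holes T} = {..<st c}" using row_c by auto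
  then have j0: "Max {j. (c, j) \<in> holes T} = st c - 1"
    using c(1) by (intro Max_eqI) auto
  have "inj_on (cell st w) {..<N}" by (auto intro: inj_onI dest: cell_inj)
  then have card: "card (dom T) = N" unfolding places_dom[OF T] by (simp add: card_image)
  have "holes T \<noteq> {}" using row_c[of 0] c(1) by auto
  then have "jdt_step T = jdt_hole (Suc N) T (hole 0)"
    using i0 j0 card by (simp add: jdt_step_def hole_def Let_def del: jdt_hole.simps)
  moreover have "mixed 0 = cell st w" by (simp add: mixed_def fun_eq_iff)
  ultimately show ?thesis using jdt_hole_slide[of 0 N T "Suc N"] T by simp
qed

lemma jdt_step_funpow_fixed: "holes T = {} \<Longrightarrow> (jdt_step ^^ n) T = T"
  by (induction n) (auto simp: jdt_step_def)

text \<open>Without holes \<open>jdt_step\<close> is the identity, so any sufficient number of steps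
  agrees with the least one.\<close>

lemma rect_eq:
  assumes "holes ((jdt_step ^^ n) T) = {}"
  shows "rect T = (jdt_step ^^ n) T"
proof -
  let ?l = "LEAST n. holes ((jdt_step ^^ n) T) = {}"
  have l: "holes ((jdt_step ^^ ?l) T) = {}" "?l \<le> n"
    using LeastI[of "\<lambda>n. holes ((jdt_step ^^ n) T) = {}"] Least_le[of "\<lambda>n. holes ((jdt_step ^^ n) T) = {}"]
      assms by auto
  have "(jdt_step ^^ n) T = (jdt_step ^^ (n - ?l)) ((jdt_step ^^ ?l) T)"
    using l(2) by (simp flip: funpow_add[THEN fun_cong, unfolded comp_def])
  then show ?thesis using jdt_step_funpow_fixed[OF l(1)] by (simp add: rect_def)
qed

text \<open>After \<open>k\<close> of the slides starting in row \<open>c\<close>, the moved entries are described in terms of the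
  original row ends \<open>e0\<close>.  The induction works because the hole of each further slide stays weakly
  below the holes of all earlier ones (fact \<open>below\<close>), so no entry moves up twice.\<close>

lemma phase_slides:
  fixes st w c
  defines "e0 \<equiv> row_end st w"
  assumes T: "places N (cell st w) T" and lat: "lattice_word st w"
    and zero: "\<And>i. c < i \<Longrightarrow> st i = 0" and s: "s < N" "w s = c"
    and k: "k \<le> st c"
  shows "\<exists>w'. places N (cell (st(c := st c - k)) w') ((jdt_step ^^ k) T) \<and>
     lattice_word (st(c := st c - k)) w' \<and>
     (\<forall>i t. c \<le> i \<longrightarrow> e0 (Suc i) t \<le> row_end (st(c := st c - k)) w' i t) \<and>
     (\<forall>t. w' t = (if c < w t \<and> row_end (st(c := st c - k)) w' (w t - 1) t = e0 (w t) t
                  then w t - 1 else w t))"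
  using k
proof (induction k)
  case 0
  \<comment> \<open>An entry placed in a row that already ends level with the row above would
    violate the lattice condition at \<open>Suc t\<close>.\<close>
  have stays: "\<not> (c < w t \<and> row_end st w (w t - 1) t = row_end st w (w t) t)" for t
  proof
    assume *: "c < w t \<and> row_end st w (w t - 1) t = row_end st w (w t) t"
    then obtain i where "w t = Suc i" by (cases "w t") auto
    then show False
      using * lat[unfolded lattice_word_def, rule_format, of i "Suc t"] by simp
  qed
  have "\<forall>t. w t = (if c < w t \<and> row_end st w (w t - 1) t = e0 (w t) t then w t - 1 else w t)"
    by (simp only: e0_def stays if_False simp_thms)
  then show ?case
    using T lat unfolding e0_def lattice_word_def
    by (intro exI[of _ w]) (simp only: fun_upd_triv diff_zero funpow.simps id_apply simp_thms)
next
  case (Suc k)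
  define st1 where "st1 = st(c := st c - k)"
  obtain w1 where
    T1: "places N (cell st1 w1) ((jdt_step ^^ k) T)" and
    lat1: "lattice_word st1 w1" and
    inter: "\<And>i t. c \<le> i \<Longrightarrow> e0 (Suc i) t \<le> row_end st1 w1 i t" and
    w1: "\<And>t. w1 t = (if c < w t \<and> row_end st1 w1 (w t - 1) t = e0 (w t) t then w t - 1 else w t)"
  proof -
    have "k \<le> st c" using Suc.prems by simp
    from Suc.IH[OF this, folded st1_def] show ?thesis using that by blast
  qed
  interpret slide st1 w1 c
    using lat1 zero[of "Suc c"] Suc.prems unfolding lattice_word_def by unfold_locales (auto simp: st1_def)
  have st2: "st(c := st c - Suc k) = starts" unfolding starts_def by (simp add: st1_def fun_eq_iff)
  have T2: "places N (cell starts word) ((jdt_step ^^ Suc k) T)"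
  proof -
    have "w1 s = c" using s(2) w1[of s] by simp
    moreover have "0 < st1 c" "\<And>i. c < i \<Longrightarrow> st1 i = 0" using Suc.prems zero by (simp_all add: st1_def)
    ultimately show ?thesis using jdt_step_slide[OF T1 lat1, of c s] s(1) by simp
  qed
  have e0_lat: "e0 (Suc i) t \<le> e0 i t" for i t
    using lat unfolding lattice_word_def e0_def by simp
  have no_block: "e0 i t \<noteq> e0 (Suc i) t" if "w t = Suc i" for i t
    using e0_lat[of i "Suc t"] that unfolding e0_def by simp
  have hole_ge: "c \<le> hole_row t" for t
    by (induction t) auto
  have below: "row_end st1 w1 i t = e0 i t" if "hole_row t < i" for i t
    using that
  proof (induction t arbitrary: i)
    case 0
    then have "i \<noteq> c" by simp
    then show ?case by (simp add: st1_def e0_def)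
  next
    case (Suc t)
    have i: "hole_row t < i" using Suc.prems by (auto split: if_splits)
    \<comment> \<open>Had an entry from a row below \<open>hole_row (Suc t)\<close> been raised
      earlier, its target row \<open>i0\<close> would be \<open>hole_row t\<close>, against
      \<open>gap\<close>, or lie below it, against \<open>no_block\<close>.\<close>
    have "w1 t = w t \<or> w t \<le> hole_row (Suc t)"
    proof (rule ccontr)
      assume asm: "\<not> ?thesis"
      with w1[of t] have mv: "c < w t" "row_end st1 w1 (w t - 1) t = e0 (w t) t"
        by (auto split: if_splits)
      then obtain i0 where i0: "w t = Suc i0" by (cases "w t") auto
      have "hole_row t \<le> i0" using asm i0 by (auto split: if_splits)
      show False
      proof (cases "i0 = hole_row t")
        case True
        then show False using mv gap[of t] Suc.IH[of "Suc i0"] i0 by simp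
      next
        case False
        then have "row_end st1 w1 i0 t = e0 i0 t" using Suc.IH[of i0] \<open>hole_row t \<le> i0\<close> by simp
        then show False using mv i0 no_block[OF i0] by simp
      qed
    qed
    moreover have "w1 t \<le> w t" using w1[of t] by (auto split: if_splits)
    ultimately have "w1 t = i \<longleftrightarrow> w t = i" using Suc.prems by auto
    then show ?case using Suc.IH[OF i] by (simp add: e0_def)
  qed
  have inter2: "e0 (Suc i) t \<le> row_end starts word i t" if "c \<le> i" for i t
  proof (cases "i = hole_row t")
    case True
    then have "e0 (Suc i) t = row_end starts word (Suc i) t"
      using below[of t "Suc i"] by (simp add: row_end_word)
    then show ?thesis using lattice'[of i t] by simp
  next
    case False
    then show ?thesis using inter[OF that, of t] by (simp add: row_end_word)
  qed
  have word: "word t = (if c < w t \<and> row_end starts word (w t - 1) t = e0 (w t) t then w t - 1 else w t)" for t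
  proof (cases "c < w t")
    case False
    then show ?thesis using w1[of t] hole_ge[of t] by (simp add: word_def)
  next
    case True
    then obtain i where i: "w t = Suc i" "c \<le> i" by (cases "w t") auto
    show ?thesis
    proof (cases "row_end st1 w1 i t = e0 (Suc i) t")
      \<comment> \<open>Interlacing keeps the equality for an entry already raised, and
        \<open>below\<close> with \<open>no_block\<close> prevents the hole from being in the row
        above its new one.\<close>
      case moved: True
      then have w1t: "w1 t = i" using w1[of t] i by simp
      have "row_end starts word i t = e0 (Suc i) t"
        using inter2[OF i(2), of t] moved by (simp add: row_end_word)
      moreover have "i \<noteq> Suc (hole_row t)"
        using moved below[of t i] no_block[OF i(1)] by auto
      ultimately show ?thesis using i w1t by (simp add: word_def)
    next
      case False
      then have w1t: "w1 t = Suc i" using w1[of t] i by simp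
      \<comment> \<open>An entry not yet raised crosses exactly when the hole shortens the row above
        to the original end of row \<open>Suc i\<close>.\<close>
      have "row_end starts word i t = e0 (Suc i) t \<longleftrightarrow>
        i = hole_row t \<and> Suc (row_end st1 w1 (Suc i) t) = row_end st1 w1 i t"
        using False below[of t "Suc i"] gap[of t] by (auto simp: row_end_word)
      then show ?thesis using i w1t by (auto simp: word_def)
    qed
  qed
  have lat2: "lattice_word starts word" using lattice' by (simp add: lattice_word_def)
  show ?case unfolding st2
    by (intro exI[of _ word] conjI allI impI) (rule T2 lat2 inter2 word | assumption)+
qed

text \<open>With \<open>k = st c\<close> the starts of row \<open>c\<close> and all lower rows
  vanish, and comparing row ends becomes comparing counts.\<close>

lemma phase:
  assumes T: "places N (cell st w) T" and lat: "lattice_word st w"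
    and zero: "\<And>i. c < i \<Longrightarrow> st i = 0" and s: "s < N" "w s = c"
  shows "\<exists>w'. places N (cell (st(c := 0)) w') ((jdt_step ^^ st c) T) \<and> lattice_word (st(c := 0)) w' \<and>
     raises c w w'"
proof -
  obtain w' where w': "places N (cell (st(c := 0)) w') ((jdt_step ^^ st c) T)" "lattice_word (st(c := 0)) w'"
    "\<And>t. w' t = (if c < w t \<and> row_end (st(c := 0)) w' (w t - 1) t = row_end st w (w t) t
                  then w t - 1 else w t)"
    using phase_slides[OF T lat zero s order_refl, unfolded diff_self_eq_0] by blast
  have "row_end (st(c := 0)) w' (w t - 1) t = row_end st w (w t) t \<longleftrightarrow> cnt w' (w t - 1) t = cnt w (w t) t"
    if "c < w t" for t
    using that zero[of "w t"] zero[of "w t - 1"] by (cases "w t - 1 = c") (auto simp: row_end_def)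
  then have "w' t = (if c < w t \<and> cnt w' (w t - 1) t = cnt w (w t) t then w t - 1 else w t)" for t
    using w'(3)[of t] by (cases "c < w t") auto
  then show ?thesis using w'(1,2) unfolding raises_def by blast
qed

text \<open>Phases run from the bottom row upwards. Letters below \<open>c\<close> stay unchanged
  until then, so row \<open>c\<close> is nonempty when its phase begins.\<close>

lemma rectification_phases:
  assumes T: "places N (cell st v) T" and lat: "lattice_word st v"
    and zero: "\<And>i. b \<le> i \<Longrightarrow> st i = 0" and rows: "\<And>i. i < b \<Longrightarrow> \<exists>s<N. v s = i"
  obtains R where "R b = v" "places N (cell (\<lambda>_. 0) (R 0)) (rect T)"
    "\<And>c. c < b \<Longrightarrow> raises c (R (Suc c)) (R c)"
proof -
  have "\<exists>R n. R b = v \<and>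
      places N (cell (\<lambda>i. if i < c then st i else 0) (R c)) ((jdt_step ^^ n) T) \<and>
      lattice_word (\<lambda>i. if i < c then st i else 0) (R c) \<and>
      (\<forall>s. v s < c \<longrightarrow> R c s = v s) \<and>
      (\<forall>d. c \<le> d \<and> d < b \<longrightarrow> raises d (R (Suc d)) (R d))" if "c \<le> b" for c
    using that
  proof (induction rule: inc_induct)
    case base
    have "(\<lambda>i. if i < b then st i else 0) = st" using zero by auto
    then show ?case using T lat by (intro exI[of _ "\<lambda>_. v"] exI[of _ 0]) auto
  next
    case (step c)
    let ?st = "\<lambda>c i. if i < c then st i else 0"
    obtain R n where R: "R b = v"
      "places N (cell (?st (Suc c)) (R (Suc c))) ((jdt_step ^^ n) T)"
      "lattice_word (?st (Suc c)) (R (Suc c))"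
      "\<And>s. v s < Suc c \<Longrightarrow> R (Suc c) s = v s"
      "\<And>d. Suc c \<le> d \<Longrightarrow> d < b \<Longrightarrow> raises d (R (Suc d)) (R d)"
      using step.IH by blast
    obtain s where "s < N" "v s = c" using rows step.hyps by blast
    then have s: "s < N" "R (Suc c) s = c" using R(4)[of s] by auto
    obtain w' where w':
      "places N (cell ((?st (Suc c))(c := 0)) w') ((jdt_step ^^ st c) ((jdt_step ^^ n) T))"
      "lattice_word ((?st (Suc c))(c := 0)) w'"
      "raises c (R (Suc c)) w'"
      using phase[OF R(2,3) _ s] by auto
    have st: "(?st (Suc c))(c := 0) = ?st c" by auto
    have "raises d ((R(c := w')) (Suc d)) ((R(c := w')) d)" if "c \<le> d" "d < b" for d
      using w'(3) R(5)[of d] that by (cases "d = c") auto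
    moreover have "w' s = v s" if "v s < c" for s
      using w'(3)[unfolded raises_def, rule_format, of s] R(4)[of s] that by simp
    moreover have "(R(c := w')) b = v" using R(1) step.hyps by simp
    moreover have "(jdt_step ^^ st c) ((jdt_step ^^ n) T) = (jdt_step ^^ (st c + n)) T"
      by (simp add: funpow_add)
    ultimately show ?case
      using w'(1,2) unfolding st
      by (intro exI[of _ "R(c := w')"] exI[of _ "st c + n"]) simp
  qed
  from this[of 0] obtain R n where R: "R b = v"
      "places N (cell (\<lambda>i. 0) (R 0)) ((jdt_step ^^ n) T)"
      "lattice_word (\<lambda>i. 0) (R 0)"
      "\<And>d. d < b \<Longrightarrow> raises d (R (Suc d)) (R d)"
    by auto
  have "holes ((jdt_step ^^ n) T) = {}" using holes_places[OF R(2,3)] by auto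
  from rect_eq[OF this] have "rect T = (jdt_step ^^ n) T" .
  then show ?thesis using that R by metis
qed

section \<open>Powers of rectangular-row skew tableaux\<close>

lemma cnt_add:
  assumes "\<And>s. v (s + m) = v s"
  shows "cnt v i (t + m) = cnt v i t + cnt v i m"
  using assms by (induction t) auto

lemma cnt_add_mult:
  assumes "\<And>s. v (s + m) = v s"
  shows "cnt v i (t + q * m) = cnt v i t + q * cnt v i m"
proof (induction q)
  case (Suc q)
  then show ?case using cnt_add[of v m i "t + q * m"] assms by (simp add: algebra_simps)
qed simp

lemma skew_shape_row:
  assumes "is_skew_shape D"
  obtains lo hi :: "nat \<Rightarrow> nat" where "\<And>i j. (i, j) \<in> D \<longleftrightarrow> lo i \<le> j \<and> j < hi i"
    "\<And>i. lo (Suc i) \<le> lo i"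
proof -
  obtain lam mu where lm: "is_partition mu" "D = skew_diagram lam mu"
    using assms unfolding is_skew_shape_def by blast
  show ?thesis
  proof
    show "(i, j) \<in> D \<longleftrightarrow> (if i < length mu then mu ! i else 0) \<le> j \<and> j < (if i < length lam then lam ! i else 0)" for i j
      using lm(2) by (auto simp: skew_diagram_def)
    show "(if Suc i < length mu then mu ! Suc i else 0) \<le> (if i < length mu then mu ! i else 0)" for i
      using lm(1) sorted_wrt_nth_less[of "(\<ge>)" mu i "Suc i"] by (auto simp: is_partition_def)
  qed
qed

section \<open>The row word of the tableau and of its powers\<close>

locale rectangular_skew_tableau =
  fixes S :: tableau and b r :: nat
  assumes b_pos: "1 \<le> b" and r_pos: "1 \<le> r"
    and std: "standard_skew_tableau S (b * r)"
    and len: "i < b \<Longrightarrow> row_len S i = r"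
    and empty: "b \<le> i \<Longrightarrow> row_cols S i = {}"
begin

definition m :: nat where "m = b * r"
definition starts :: "nat \<Rightarrow> nat" where "starts i = (if i < b then row_start S i else 0)"
text \<open>Reduction modulo \<open>m\<close> makes the word periodic, so one word serves all powers
  of \<open>S\<close>.\<close>

definition row_of :: "nat \<Rightarrow> nat" where
  "row_of s = (THE i. \<exists>j. S (i, j) = Some (Suc (s mod m)))"

lemma m_pos: "0 < m"
  using b_pos r_pos by (simp add: m_def)

lemma card_dom: "card (dom S) = m"
  using std by (simp add: standard_skew_tableau_def m_def)

lemma row_shape:
  shows dom_iff: "(i, j) \<in> dom S \<longleftrightarrow> i < b \<and> starts i \<le> j \<and> j < starts i + r"
    and starts_antimono: "starts (Suc i) \<le> starts i"
proof -
  obtain lo hi where D: "\<And>i j. (i, j) \<in> dom S \<longleftrightarrow> lo i \<le> j \<and> j < hi i"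
    and lo: "\<And>i. lo (Suc i) \<le> lo i"
    using std skew_shape_row[of "dom S"] unfolding standard_skew_tableau_def by metis
  have cols: "row_cols S i = {lo i..<hi i}" for i
    using D by (auto simp: row_cols_def)
  have start: "starts i = lo i \<and> hi i = lo i + r" if "i < b" for i
  proof -
    have "hi i - lo i = r" using len[OF that] by (simp add: row_len_def cols)
    then have "lo i < hi i" using r_pos by simp
    then have "Min {lo i..<hi i} = lo i" by (intro Min_eqI) auto
    then show ?thesis using that \<open>hi i - lo i = r\<close> r_pos
      by (simp add: starts_def row_start_def cols)
  qed
  show "(i, j) \<in> dom S \<longleftrightarrow> i < b \<and> starts i \<le> j \<and> j < starts i + r"
    using start[of i] D[of i j] empty[of i] cols[of i] by (cases "i < b") auto
  show "starts (Suc i) \<le> starts i"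
    using start[of i] start[of "Suc i"] lo[of i] by (auto simp: starts_def)
qed

text \<open>\<open>S\<close> maps \<open>m\<close> cells onto \<open>m\<close> values.\<close>

lemma S_inj: "S c = Some x \<Longrightarrow> S c' = Some x \<Longrightarrow> c = c'"
proof -
  have "card ((the \<circ> S) ` dom S) = card (dom S)"
  proof -
    have "(the \<circ> S) ` dom S = ran S" by (force simp: ran_def dom_def)
    then show ?thesis using std card_dom by (simp add: standard_skew_tableau_def m_def)
  qed
  moreover have "finite (dom S)" using card_dom m_pos card_ge_0_finite by metis
  ultimately have "inj_on (the \<circ> S) (dom S)" by (simp add: eq_card_imp_inj_on)
  moreover assume "S c = Some x" "S c' = Some x"
  ultimately show "c = c'" by (metis comp_apply domI inj_onD option.sel)
qed

lemma S_range: "(\<exists>c. S c = Some x) \<longleftrightarrow> 1 \<le> x \<and> x \<le> m"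
proof -
  have "(\<exists>c. S c = Some x) \<longleftrightarrow> x \<in> ran S" by (auto simp: ran_def)
  then show ?thesis using std by (simp add: standard_skew_tableau_def m_def)
qed

lemma row_of_eqI: "S (i, j) = Some (Suc s) \<Longrightarrow> row_of s = i"
proof -
  assume S: "S (i, j) = Some (Suc s)"
  then have "s mod m = s" using S_range[of "Suc s"] by auto
  then show ?thesis unfolding row_of_def using S S_inj[OF S] by (intro the_equality) auto
qed

lemma row_of_ex:
  assumes "s < m"
  obtains j where "S (row_of s, j) = Some (Suc s)"
proof -
  obtain i j where "S (i, j) = Some (Suc s)" using S_range[of "Suc s"] assms by force
  then show ?thesis using that row_of_eqI by metis
qed

lemma row_of_period: "row_of (s + m) = row_of s"
  by (simp add: row_of_def)

lemma row_of_less: "row_of s < b"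
proof -
  obtain j where "S (row_of (s mod m), j) = Some (Suc (s mod m))"
    using row_of_ex[of "s mod m"] m_pos by auto
  then show ?thesis using dom_iff[of "row_of (s mod m)" j] by (auto simp: row_of_def)
qed

lemma row_mono: "S (i, j) = Some x \<Longrightarrow> S (i, j') = Some y \<Longrightarrow> j < j' \<longleftrightarrow> x < y"
  and col_mono: "S (i, j) = Some x \<Longrightarrow> S (i', j) = Some y \<Longrightarrow> i < i' \<Longrightarrow> x < y"
proof -
  have r: "the (S (i, j)) < the (S (i, j'))" if "(i, j) \<in> dom S" "(i, j') \<in> dom S" "j < j'" for i j j'
    using std that unfolding standard_skew_tableau_def by blast
  show "S (i, j) = Some x \<Longrightarrow> S (i, j') = Some y \<Longrightarrow> j < j' \<longleftrightarrow> x < y"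
    using r[of i j j', OF domI domI] r[of i j' j, OF domI domI]
    by (cases j j' rule: linorder_cases) fastforce+
  have "the (S (i, j)) < the (S (i', j))" if "(i, j) \<in> dom S" "(i', j) \<in> dom S" "i < i'"
    using std that unfolding standard_skew_tableau_def by blast
  then show "S (i, j) = Some x \<Longrightarrow> S (i', j) = Some y \<Longrightarrow> i < i' \<Longrightarrow> x < y" by auto
qed

lemma cnt_row_of:
  assumes "t \<le> m"
  shows "cnt row_of i t = card {j. \<exists>x. S (i, j) = Some x \<and> x \<le> t}"
proof -
  have "bij_betw (\<lambda>j. the (S (i, j)) - 1) {j. \<exists>x. S (i, j) = Some x \<and> x \<le> t} {s. s < t \<and> row_of s = i}"
  proof (rule bij_betw_imageI)
    have pos: "S c = Some x \<Longrightarrow> 0 < x" for c x using S_range[of x] by (metis less_le_trans zero_less_one)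
    show "inj_on (\<lambda>j. the (S (i, j)) - 1) {j. \<exists>x. S (i, j) = Some x \<and> x \<le> t}"
    proof (rule inj_onI, clarsimp)
      fix j j' x y assume "S (i, j) = Some x" "S (i, j') = Some y" "x - Suc 0 = y - Suc 0"
      then show "j = j'" using pos[of "(i,j)" x] pos[of "(i,j')" y] S_inj[of "(i,j)" x "(i,j')"] by auto
    qed
    show "(\<lambda>j. the (S (i, j)) - 1) ` {j. \<exists>x. S (i, j) = Some x \<and> x \<le> t} = {s. s < t \<and> row_of s = i}"
    proof (intro equalityI subsetI)
      fix s assume "s \<in> (\<lambda>j. the (S (i, j)) - 1) ` {j. \<exists>x. S (i, j) = Some x \<and> x \<le> t}"
      then obtain j x where jx: "S (i, j) = Some x" "x \<le> t" "s = x - 1" by auto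
      then have "x = Suc s" using pos[of "(i,j)" x] by simp
      then show "s \<in> {s. s < t \<and> row_of s = i}" using jx row_of_eqI by auto
    next
      fix s assume s: "s \<in> {s. s < t \<and> row_of s = i}"
      then obtain j where "S (row_of s, j) = Some (Suc s)" using row_of_ex[of s] assms by auto
      then show "s \<in> (\<lambda>j. the (S (i, j)) - 1) ` {j. \<exists>x. S (i, j) = Some x \<and> x \<le> t}"
        using s by (intro image_eqI[of _ _ j]) auto
    qed
  qed
  from bij_betw_same_card[OF this] show ?thesis by (simp add: cnt_def)
qed

text \<open>As rows increase, the entries up to \<open>t\<close> fill an initial interval of row
  \<open>i\<close>.\<close>

lemma initial_cols:
  assumes "t \<le> m" "i < b"
  shows "(\<exists>x. S (i, j) = Some x \<and> x \<le> t) \<longleftrightarrow> starts i \<le> j \<and> j < starts i + cnt row_of i t"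
proof -
  let ?J = "{j. \<exists>x. S (i, j) = Some x \<and> x \<le> t}"
  have sub: "?J \<subseteq> {starts i..<starts i + r}"
  proof
    fix j assume "j \<in> ?J"
    then have "(i, j) \<in> dom S" by auto
    then show "j \<in> {starts i..<starts i + r}" using dom_iff by simp
  qed
  then have fin: "finite ?J" by (rule finite_subset) simp
  have down: "j' \<in> ?J" if "j \<in> ?J" "starts i \<le> j'" "j' \<le> j" for j j'
  proof -
    from that(1) obtain x where x: "S (i, j) = Some x" "x \<le> t" by auto
    then have "(i, j') \<in> dom S" using dom_iff[of i j] dom_iff[of i j'] that assms by (auto simp: dom_def)
    then obtain y where y: "S (i, j') = Some y" by auto
    then have "y \<le> x" using row_mono[OF x(1) y] that by auto
    then show ?thesis using x y by auto
  qed
  have "\<exists>k. ?J = {starts i..<k}"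
  proof (cases "?J = {}")
    case True then show ?thesis by auto
  next
    case False
    have "?J = {starts i..<Suc (Max ?J)}"
      using down[OF Max_in[OF fin False]] Max_ge[OF fin] sub by (auto simp: less_Suc_eq_le)
    then show ?thesis by blast
  qed
  then obtain k where k: "?J = {starts i..<k}" by blast
  then have "cnt row_of i t = k - starts i" using cnt_row_of[OF assms(1), of i] by simp
  moreover have "j \<in> ?J \<longleftrightarrow> j \<in> {starts i..<k}" using k by blast
  ultimately show ?thesis by auto
qed

lemma cnt_m: "i < b \<Longrightarrow> cnt row_of i m = r"
proof -
  assume i: "i < b"
  have "(\<exists>x. S (i, j) = Some x \<and> x \<le> m) \<longleftrightarrow> (i, j) \<in> dom S" for j
    using S_range by (auto simp: dom_def)
  then have "(starts i \<le> j \<and> j < starts i + cnt row_of i m) = (starts i \<le> j \<and> j < starts i + r)" for j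
    using initial_cols[of m i j] dom_iff[of i j] i by simp
  from this[of "starts i + r"] this[of "starts i + cnt row_of i m"] show ?thesis by auto
qed

lemma S_eq: "S (i, j) = Some (Suc s) \<longleftrightarrow> s < m \<and> cell starts row_of s = (i, j)"
proof -
  have *: "cell starts row_of s = (i, j)" if S: "S (i, j) = Some (Suc s)" for i j
  proof -
    have i: "row_of s = i" "i < b" "s < m"
      using row_of_eqI[OF S] row_of_less[of s] S_range[of "Suc s"] S by auto
    have "starts i \<le> j \<and> j < starts i + cnt row_of i (Suc s)"
      using initial_cols[of "Suc s" i j] i S by auto
    moreover have "\<not> (starts i \<le> j \<and> j < starts i + cnt row_of i s)"
      using initial_cols[of s i j] i S by auto
    ultimately show ?thesis using i by (auto simp: cell_def row_end_def)
  qed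
  show ?thesis
  proof
    assume "S (i, j) = Some (Suc s)"
    then show "s < m \<and> cell starts row_of s = (i, j)" using * S_range[of "Suc s"] by auto
  next
    assume s: "s < m \<and> cell starts row_of s = (i, j)"
    then obtain j' where "S (row_of s, j') = Some (Suc s)" using row_of_ex by blast
    then show "S (i, j) = Some (Suc s)" using *[of "row_of s" j'] s by simp
  qed
qed

text \<open>In the first period, a row protruding beyond the one above would have an entry below a
  larger one. Every row gains \<open>r\<close> cells per period, so the inequality extends to all
  times.\<close>

lemma lattice: "lattice_word starts row_of"
proof -
  have base: "row_end starts row_of (Suc i) t \<le> row_end starts row_of i t" if t: "t \<le> m" "Suc i < b" for i t
  proof (rule ccontr)
    define j where "j = starts (Suc i) + cnt row_of (Suc i) t - 1"
    assume "\<not> ?thesis"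
    then have j: "starts (Suc i) \<le> j" "j < starts (Suc i) + cnt row_of (Suc i) t"
      "starts i + cnt row_of i t \<le> j"
      using starts_antimono[of i] unfolding row_end_def j_def by linarith+
    obtain x where x: "S (Suc i, j) = Some x" "x \<le> t"
      using initial_cols[of t "Suc i" j] t j by auto
    then have "(i, j) \<in> dom S"
      using dom_iff[of "Suc i" j] dom_iff[of i j] starts_antimono[of i] j that by (auto simp: dom_def)
    then obtain y where y: "S (i, j) = Some y" by auto
    have "y < x" using col_mono[OF y x(1)] by simp
    then have "j < starts i + cnt row_of i t" using initial_cols[of t i j] that x y by auto
    then show False using j by simp
  qed
  have all: "row_end starts row_of (Suc i) t \<le> row_end starts row_of i t" for i t
  proof (cases "Suc i < b")
    case True
    have "cnt row_of i' t = cnt row_of i' (t mod m) + (t div m) * r" if "i' < b" for i'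
      using cnt_add_mult[of row_of m i' "t mod m" "t div m"] cnt_m[OF that] row_of_period
      by (simp add: mod_div_mult_eq)
    then show ?thesis using base[of "t mod m" i] True m_pos by (simp add: row_end_def)
  next
    case False
    then have "starts (Suc i) = 0" by (simp add: starts_def)
    moreover have "row_of s \<noteq> Suc i" for s using row_of_less[of s] False by auto
    ultimately show ?thesis by (simp add: row_end_def cnt_def)
  qed
  then show ?thesis by (simp add: lattice_word_def)
qed

text \<open>Each row has \<open>r\<close> entries per period, so dividing the column offset by
  \<open>r\<close> gives the same copy number as dividing \<open>s\<close> by
  \<open>m\<close>.\<close>

lemma places_power: "places (k * m) (cell starts row_of) (tab_power S k)"
proof -
  have "tab_power S k (i, j) = Some x \<longleftrightarrow> (\<exists>s<k * m. x = Suc s \<and> cell starts row_of s = (i, j))" for i j x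
  proof (cases "i < b")
    case False
    then show ?thesis using row_of_less empty[of i] by (auto simp: tab_power_def cell_def)
  next
    case True
    have ne: "row_cols S i \<noteq> {}" using len[OF True] r_pos by (auto simp: row_len_def)
    let ?d = "j - starts i"
    have pw: "tab_power S k (i, j) = (if starts i \<le> j \<and> j < starts i + k * r
        then map_option (\<lambda>x. x + (?d div r) * m) (S (i, starts i + ?d mod r)) else None)"
      using True ne len card_dom by (simp add: tab_power_def starts_def Let_def)
    show ?thesis
    proof
      assume L: "tab_power S k (i, j) = Some x"
      then have j: "starts i \<le> j" "?d < k * r"
        and "map_option (\<lambda>x. x + (?d div r) * m) (S (i, starts i + ?d mod r)) = Some x"
        unfolding pw by (auto split: if_splits)
      then obtain y where y: "S (i, starts i + ?d mod r) = Some y" "x = y + (?d div r) * m" by auto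
      obtain s where s: "y = Suc s" using y(1) S_range[of y] by (cases y) auto
      have c: "s < m" "cell starts row_of s = (i, starts i + ?d mod r)" using S_eq y(1) s by auto
      have q: "Suc (?d div r) \<le> k" using j(2) by (simp add: less_mult_imp_div_less Suc_leI)
      have "s + (?d div r) * m < k * m"
        using c(1) mult_le_mono1[OF q, of m] by simp
      moreover have "cell starts row_of (s + (?d div r) * m) = (i, j)"
      proof -
        have i: "row_of s = i" "cnt row_of i s = ?d mod r" using c(2) by (auto simp: cell_def row_end_def)
        have "row_of (s + (?d div r) * m) = i" using i by (simp add: row_of_def)
        moreover have "cnt row_of i (s + (?d div r) * m) = ?d"
          using cnt_add_mult[of row_of m i s "?d div r"] row_of_period cnt_m[OF True] i by simp
        ultimately show ?thesis using j by (simp add: cell_def row_end_def)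
      qed
      ultimately show "\<exists>s<k * m. x = Suc s \<and> cell starts row_of s = (i, j)"
        using y(2) s by (intro exI[of _ "s + (?d div r) * m"]) simp
    next
      assume "\<exists>s<k * m. x = Suc s \<and> cell starts row_of s = (i, j)"
      then obtain s where s: "s < k * m" "x = Suc s" "cell starts row_of s = (i, j)" by blast
      let ?s = "s mod m" and ?q = "s div m"
      have i: "row_of s = i" "row_of ?s = i" using s(3) by (auto simp: cell_def row_of_def)
      have "s = ?s + ?q * m" by (simp only: mod_div_mult_eq)
      then have "cnt row_of i s = cnt row_of i ?s + ?q * r"
        using cnt_add_mult[of row_of m i ?s ?q] row_of_period cnt_m[OF True] by simp
      then have j: "starts i \<le> j" "?d = cnt row_of i ?s + ?q * r"
        using s(3) i by (auto simp: cell_def row_end_def)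
      have "?s < m" using m_pos by simp
      then have S: "S (i, starts i + cnt row_of i ?s) = Some (Suc ?s)"
        using S_eq i by (simp add: cell_def row_end_def)
      then have lt: "cnt row_of i ?s < r" using dom_iff[of i "starts i + cnt row_of i ?s"] by (auto simp: dom_def)
      have d: "?d div r = ?q" "?d mod r = cnt row_of i ?s" using j(2) lt by auto
      have "Suc ?q \<le> k" using s(1) by (simp add: less_mult_imp_div_less Suc_leI)
      then have "?d < k * r" using j(2) lt mult_le_mono1[of "Suc ?q" k r] by simp
      then show "tab_power S k (i, j) = Some x"
        unfolding pw using j(1) S d s(2) by (simp add: mod_div_mult_eq less_diff_conv2)
    qed
  qed
  then show ?thesis unfolding places_def by auto
qed

lemma stabilizes: "stabilizes_at S b"
proof -
  have rows: "\<exists>s<b * m. row_of s = i" if "i < b" for i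
  proof -
    have "(i, starts i) \<in> dom S" using dom_iff[of i "starts i"] that r_pos by simp
    then obtain x where x: "S (i, starts i) = Some x" by auto
    then obtain s where "x = Suc s" using S_range[of x] by (cases x) auto
    then have "s < m" "row_of s = i" using S_range[of x] row_of_eqI x by auto
    moreover have "m \<le> b * m" using b_pos by simp
    ultimately show ?thesis using order_less_le_trans by blast
  qed
  have "starts i = 0" if "b \<le> i" for i using that by (simp add: starts_def)
  then obtain R where R: "R b = row_of" "places (b * m) (cell (\<lambda>_. 0) (R 0)) (rect (tab_power S b))"
    "\<And>c. c < b \<Longrightarrow> raises c (R (Suc c)) (R c)"
    using rectification_phases[OF places_power lattice _ rows] by blast
  \<comment> \<open>The queues run on the infinite periodic word; the tableau records its first
    \<open>b * m\<close> letters.\<close>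
  interpret cascade b m r R
  proof
    show "cnt (R b) i (t + m) = cnt (R b) i t + r" if "i < b" for i t
      using cnt_add[of row_of m i t] row_of_period cnt_m[OF that] R(1) by simp
  qed (use m_pos row_of_less R in auto)
  show ?thesis
    unfolding stabilizes_at_def
  proof (intro ballI allI impI)
    fix x i j i' j'
    assume x: "x \<in> {(b - 1) * card (dom S) + 1..b * card (dom S)}"
      and c: "tab_power S b (i, j) = Some x" "rect (tab_power S b) (i', j') = Some x"
    obtain s where s: "x = Suc s" "cell starts row_of s = (i, j)"
      using places_Some[OF places_power, of b "(i, j)" x] c(1) by metis
    have "(b - 1) * m \<le> s" using x s(1) card_dom by simp
    then have "R 0 s = row_of s" using eventually_fixed R(1) by simp
    moreover have "cell (\<lambda>_. 0) (R 0) s = (i', j')"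
      using places_Some[OF R(2), of "(i', j')" x] c(2) s(1) by auto
    ultimately show "i = i'" using s(2) by (simp add: cell_def)
  qed
qed

end

theorem theorem1p4:
  fixes S :: tableau and b r :: nat
  assumes "1 \<le> b" and "1 \<le> r"
    and "standard_skew_tableau S (b * r)"
    and "\<forall>i < b. row_len S i = r"
    and "\<forall>i \<ge> b. row_cols S i = {}"
  shows "stabilizes_at S b \<and> stab S \<le> b"
proof -
  interpret rectangular_skew_tableau S b r
    using assms by unfold_locales auto
  show ?thesis using stabilizes assms(1) unfolding stab_def by (auto intro: Least_le)
qed

end
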